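(* A ribbon nerve is an Edelsbrunner-Harer nerve.
   Context: A cell in the Euclidean plane is a vertex, an edge or a filled triangle, and a cell complex is a nonempty collection of cells. A planar CW space $K$ is a nonempty collection of cell complexes that is Hausdorff (every pair of distinct cells is contained in disjoint neighbourhoods) and such that the closure of each cell complex is in $K$ and every nonempty intersection of cell complexes is in $K$. A filled planar cycle $\mathrm{cyc}\,A$ includes the part of the plane inside its boundary; it has nonempty interior, and its boundary contains a nonempty finite collection of path-connected vertices, so that there is a path between any pair of vertices of the cycle. $\mathrm{cl}$, $\mathrm{int}$, $\mathrm{bdy}$ denote closure, interior and boundary. Two filled cycles are nesting if one contains the other entirely within its interior. Let $\mathrm{cyc}\,A,\mathrm{cyc}\,B$ be nesting filled cycles, with $\mathrm{cyc}\,B$ in the interior of $\mathrm{cyc}\,A$, defined on a collection of vertices $E$ on a finite, bounded planar region in a CW space $K$. The planar ribbon $\mathrm{rb}\,E$ is $\mathrm{cl}(\mathrm{cyc}\,A)\setminus\mathrm{int}(\mathrm{cyc}\,B)$: it includes its outer boundary $\mathrm{bdy}(\mathrm{cyc}\,A)$ and its inner boundary $\mathrm{bdy}(\mathrm{cyc}\,B)$, which are simple closed curves, and excludes the interior of the inner cycle. A (Vergili) ribbon complex $\mathrm{rbx}\,K$ is a nonempty collection of countable planar ribbons in a CW space $K$, $\mathrm{rbx}\,K=\{\mathrm{rb}\,E : E\in 2^{\mathrm{Vert}K}\}$, where $2^{\mathrm{Vert}K}$ is the collection of subsets of vertices in $K$. A ribbon nerve, denoted $\mathrm{rbNrv}\,K$,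 is a nonempty collection of planar ribbons in a ribbon complex $\mathrm{rbx}\,K$ that have nonempty intersection, written $\mathrm{rbNrv}\,K=\{\mathrm{rb}\,E\in\mathrm{rbx}\,K : \bigcap \mathrm{rb}\,E\neq\emptyset\}$. For a finite, nonempty collection $F$ of sets, an Edelsbrunner-Harer nerve, denoted $\mathrm{Nrv}\,F$, consists of all nonempty subcollections of $F$ whose sets have nonempty intersection, i.e. $\mathrm{Nrv}\,F=\{X\subseteq F : \bigcap X\neq\emptyset\}$.
   Formalization: All ribbons of the complex are taken on one common finite, bounded region of K; otherwise infinitely many ribbons sharing an inner cycle form an infinite ribbon nerve, which is no nerve of a finite F. The Hausdorff condition is read pointwise, for open cells. *)

theory Defs
  imports "HOL-Analysis.Analysis"
begin

type_synonym plane = "real^2"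
type_synonym cell = "plane set"

text \<open>Cells are relatively open, as in CW complexes, so that distinct cells of a space can be
  disjoint. A cell complex is a set of cells and a CW space is a set of cell complexes.\<close>

definition is_vertex :: "cell \<Rightarrow> bool" where
  "is_vertex c \<longleftrightarrow> (\<exists>v. c = {v})"

definition is_edge :: "cell \<Rightarrow> bool" where
  "is_edge c \<longleftrightarrow> (\<exists>a b. a \<noteq> b \<and> c = open_segment a b)"

definition is_filled_triangle :: "cell \<Rightarrow> bool" where
  "is_filled_triangle c \<longleftrightarrow>
     (\<exists>p q r. \<not> collinear {p, q, r} \<and> c = interior (convex hull {p, q, r}))"

definition is_cell :: "cell \<Rightarrow> bool" where
  "is_cell c \<longleftrightarrow> is_vertex c \<or> is_edge c \<or> is_filled_triangle c"

definition cell_complex :: "cell set \<Rightarrow> bool" where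
  "cell_complex C \<longleftrightarrow> C \<noteq> {} \<and> (\<forall>c\<in>C. is_cell c)"

text \<open>The closure of a cell is the cell together with its vertices and edges.\<close>

definition cell_closure :: "cell \<Rightarrow> cell set" where
  "cell_closure c = {d. is_cell d \<and> closure d face_of closure c}"

definition complex_closure :: "cell set \<Rightarrow> cell set" where
  "complex_closure C = (\<Union>c\<in>C. cell_closure c)"

definition cells :: "cell set set \<Rightarrow> cell set" where
  "cells K = \<Union>K"

definition Vert :: "cell set set \<Rightarrow> plane set" where
  "Vert K = {v. {v} \<in> cells K}"

text \<open>Separation is required for the points of distinct cells. No disjoint neighbourhoods contain
  an edge and its endpoint as whole sets, so separating whole cells would be incompatible with
  closures as soon as there is an edge.\<close>

definition hausdorff_cells :: "cell set set \<Rightarrow> bool" where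
  "hausdorff_cells K \<longleftrightarrow>
     (\<forall>c\<in>cells K. \<forall>d\<in>cells K. c \<noteq> d \<longrightarrow>
        (\<forall>x\<in>c. \<forall>y\<in>d. \<exists>U V. open U \<and> open V \<and> x \<in> U \<and> y \<in> V \<and> U \<inter> V = {}))"

definition planar_CW_space :: "cell set set \<Rightarrow> bool" where
  "planar_CW_space K \<longleftrightarrow>
     K \<noteq> {} \<and> (\<forall>C\<in>K. cell_complex C) \<and>
     hausdorff_cells K \<and>
     (\<forall>C\<in>K. complex_closure C \<in> K) \<and>
     (\<forall>G. G \<subseteq> K \<and> G \<noteq> {} \<and> \<Inter>G \<noteq> {} \<longrightarrow> \<Inter>G \<in> K)"

text \<open>\<open>V\<close> is the set of vertices of the cycle. Any two of them are joined by a path in the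
  boundary, since the boundary is the image of a closed path.\<close>

definition filled_cycle :: "cell set set \<Rightarrow> plane set \<Rightarrow> plane set \<Rightarrow> bool" where
  "filled_cycle K V A \<longleftrightarrow>
     A = frontier A \<union> inside (frontier A) \<and> interior A \<noteq> {} \<and>
     (\<exists>g. simple_path g \<and> pathfinish g = pathstart g \<and> path_image g = frontier A) \<and>
     (\<exists>C\<subseteq>cells K. (\<forall>c\<in>C. is_vertex c \<or> is_edge c) \<and> frontier A = \<Union>C \<and> V = {v. {v} \<in> C}) \<and>
     finite V \<and> V \<noteq> {}"

definition finite_bounded_region :: "cell set set \<Rightarrow> plane set \<Rightarrow> bool" where
  "finite_bounded_region K P \<longleftrightarrow> bounded P \<and> finite (Vert K \<inter> P)"

text \<open>A vertex set need not determine its ribbon, since the same vertices may carry several pairs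
  of nesting cycles; hence a relation between \<open>E\<close> and the ribbon \<open>R\<close>.\<close>

definition planar_ribbon :: "cell set set \<Rightarrow> plane set \<Rightarrow> plane set \<Rightarrow> bool" where
  "planar_ribbon K E R \<longleftrightarrow>
     (\<exists>A B V W. filled_cycle K V A \<and> filled_cycle K W B \<and> B \<subseteq> interior A \<and>
        E = V \<union> W \<and> R = closure A - interior B)"

definition rbx :: "cell set set \<Rightarrow> plane set \<Rightarrow> plane set set" where
  "rbx K P = {R. \<exists>E \<in> Pow (Vert K \<inter> P). planar_ribbon K E R}"

text \<open>\<open>rbx K P\<close> consists of all ribbons on vertices of \<open>K\<close> in the region \<open>P\<close>. A ribbon complex may
  be this collection or any nonempty part of it.\<close>

definition ribbon_complex :: "cell set set \<Rightarrow> plane set \<Rightarrow> plane set set \<Rightarrow> bool" where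
  "ribbon_complex K P \<R> \<longleftrightarrow> \<R> \<noteq> {} \<and> countable \<R> \<and> \<R> \<subseteq> rbx K P"

text \<open>\<open>ribbon_nerve\<close> describes one collection of ribbons with a common point; \<open>rbNrv\<close> is the family
  of all such collections, which is the object of the same kind as \<open>Nrv F\<close>.\<close>

definition ribbon_nerve :: "plane set set \<Rightarrow> plane set set \<Rightarrow> bool" where
  "ribbon_nerve \<R> N \<longleftrightarrow> N \<noteq> {} \<and> N \<subseteq> \<R> \<and> \<Inter>N \<noteq> {}"

definition rbNrv :: "plane set set \<Rightarrow> plane set set set" where
  "rbNrv \<R> = {N. ribbon_nerve \<R> N}"

text \<open>Nonemptiness of \<open>X\<close> is explicit because \<open>\<Inter>{} = UNIV\<close>.\<close>

definition Nrv :: "'a set set \<Rightarrow> 'a set set set" where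
  "Nrv F = {X. X \<subseteq> F \<and> X \<noteq> {} \<and> \<Inter>X \<noteq> {}}"

definition EH_nerve :: "'a set set set \<Rightarrow> bool" where
  "EH_nerve \<N> \<longleftrightarrow> (\<exists>F. finite F \<and> F \<noteq> {} \<and> \<N> = Nrv F)"

text \<open>A single collection of sets, seen as the complex of all its nonempty subcollections.\<close>

definition subcollections :: "'a set set \<Rightarrow> 'a set set set" where
  "subcollections N = {X. X \<subseteq> N \<and> X \<noteq> {}}"

end

(* The only point beyond unfolding definitions is that the ribbons on the vertices of a region
   with finitely many vertices are finite in number.  Distinct cells are disjoint and the endpoints
   of an edge of K are again cells of K, so an endpoint of an edge in the boundary of a cycle,
   which lies in that closed boundary, must be a vertex of the cycle.  Hence a boundary is a union
   of cells from a finite stock; it determines its filled cycle, and two cycles determine a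
   ribbon. *)
theory Submission
  imports Defs
begin

text \<open>A common point of distinct cells would have to be separated from itself.\<close>

lemma cells_disjoint:
  assumes "hausdorff_cells K" "c \<in> cells K" "d \<in> cells K" "x \<in> c" "x \<in> d"
  shows "c = d"
  using assms unfolding hausdorff_cells_def by (metis disjoint_iff)

lemma endpoint_in_cells:
  assumes K: "planar_CW_space K" and e: "open_segment a b \<in> cells K" "a \<noteq> b"
  shows "{a} \<in> cells K"
proof -
  obtain C where C: "C \<in> K" "open_segment a b \<in> C"
    using e by (auto simp: cells_def)
  \<comment> \<open>An endpoint is an extreme point of the closed segment, hence a face of
    it.\<close>
  have "{a} \<in> cell_closure (open_segment a b)"
    using e(2) by (simp add: cell_closure_def is_cell_def is_vertex_def face_of_singleton
        extreme_point_of_segment)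
  then have "{a} \<in> complex_closure C"
    using C(2) by (auto simp: complex_closure_def)
  moreover have "complex_closure C \<in> K"
    using K C(1) by (simp add: planar_CW_space_def)
  ultimately show ?thesis
    by (auto simp: cells_def)
qed

lemma endpoint_is_vertex_of_closed_union:
  assumes K: "planar_CW_space K" and C: "C \<subseteq> cells K" and cl: "closed (\<Union>C)"
    and e: "open_segment a b \<in> C" "a \<noteq> b"
  shows "{a} \<in> C"
proof -
  have "a \<in> closure (open_segment a b)"
    using e(2) by simp
  then have "a \<in> \<Union>C"
    using cl e(1) by (meson Union_upper closure_minimal in_mono)
  then obtain c where "c \<in> C" "a \<in> c"
    by blast
  moreover have "{a} \<in> cells K"
    using K C e by (intro endpoint_in_cells) auto
  moreover have "hausdorff_cells K"
    using K by (simp add: planar_CW_space_def)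
  ultimately show ?thesis
    using C cells_disjoint[of K c "{a}" a] by auto
qed

text \<open>The finite stock is generous: segments need not be cells of a space, and pairs with
  \<open>a = b\<close> contribute the empty set. Only finiteness and coverage matter.\<close>

definition cells_on :: "plane set \<Rightarrow> cell set" where
  "cells_on S = (\<lambda>v. {v}) ` S \<union> (\<lambda>(a, b). open_segment a b) ` (S \<times> S)"

lemma finite_cells_on: "finite S \<Longrightarrow> finite (cells_on S)"
  by (simp add: cells_on_def)

definition cycles_on :: "plane set \<Rightarrow> plane set set" where
  "cycles_on S = (\<lambda>C. \<Union>C \<union> inside (\<Union>C)) ` Pow (cells_on S)"

lemma finite_cycles_on: "finite S \<Longrightarrow> finite (cycles_on S)"
  by (simp add: cycles_on_def finite_cells_on)

lemma filled_cycle_in_cycles_on: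
  assumes K: "planar_CW_space K" and A: "filled_cycle K V A" and V: "V \<subseteq> S"
  shows "A \<in> cycles_on S"
proof -
  obtain C where C: "C \<subseteq> cells K" "\<forall>c\<in>C. is_vertex c \<or> is_edge c"
      "frontier A = \<Union>C" "V = {v. {v} \<in> C}"
    using A unfolding filled_cycle_def by blast
  have cl: "closed (\<Union>C)"
    using C(3) by (metis frontier_closed)
  have "c \<in> cells_on S" if c: "c \<in> C" for c
    using C(2)[rule_format, OF c]
  proof
    assume "is_vertex c"
    then show ?thesis
      using c C(4) V by (auto simp: is_vertex_def cells_on_def)
  next
    assume "is_edge c"
    then obtain a b where ab: "a \<noteq> b" "c = open_segment a b"
      by (auto simp: is_edge_def)
    \<comment> \<open>The endpoint lemma handles the first endpoint; reversing the segment gives the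
      other.\<close>
    have "{a} \<in> C" "{b} \<in> C"
      using endpoint_is_vertex_of_closed_union[OF K C(1) cl] c ab
      by (metis, metis open_segment_commute)
    then have "a \<in> S" "b \<in> S"
      using C(4) V by auto
    then show ?thesis
      using ab(2) by (auto simp: cells_on_def)
  qed
  moreover have "A = \<Union>C \<union> inside (\<Union>C)"
    using A C(3) by (simp add: filled_cycle_def)
  ultimately show ?thesis
    by (auto simp: cycles_on_def)
qed

text \<open>A vertex set may carry several ribbons, so the count runs over pairs of cycles: both
  cycles of a ribbon lie in the finite set \<open>?Z\<close>.\<close>

lemma finite_rbx:
  assumes K: "planar_CW_space K" and P: "finite_bounded_region K P"
  shows "finite (rbx K P)"
proof (rule finite_subset)
  let ?Z = "cycles_on (Vert K \<inter> P)"
  show "rbx K P \<subseteq> (\<lambda>(A, B). closure A - interior B) ` (?Z \<times> ?Z)"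
  proof
    fix R assume "R \<in> rbx K P"
    then obtain A B V W where "filled_cycle K V A" "filled_cycle K W B"
        "V \<union> W \<subseteq> Vert K \<inter> P" and R: "R = closure A - interior B"
      unfolding rbx_def planar_ribbon_def by blast
    then have "A \<in> ?Z" "B \<in> ?Z"
      using filled_cycle_in_cycles_on[OF K] by simp_all
    then show "R \<in> (\<lambda>(A, B). closure A - interior B) ` (?Z \<times> ?Z)"
      using R by force
  qed
  show "finite ((\<lambda>(A, B). closure A - interior B) ` (?Z \<times> ?Z))"
    using P by (simp add: finite_bounded_region_def finite_cycles_on)
qed

lemma rbNrv_eq_Nrv: "rbNrv \<R> = Nrv \<R>"
  by (auto simp: rbNrv_def ribbon_nerve_def Nrv_def)

text \<open>Dropping sets only enlarges an intersection, so a point common to \<open>N\<close> is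
  common to each of its subcollections.\<close>

lemma subcollections_eq_Nrv: "\<Inter>N \<noteq> {} \<Longrightarrow> subcollections N = Nrv N"
  unfolding subcollections_def Nrv_def by blast

theorem theorem1:
  fixes K :: "cell set set" and P :: "plane set" and \<R> :: "plane set set"
  assumes "planar_CW_space K"
    and "finite_bounded_region K P"
    and "ribbon_complex K P \<R>"
  shows "EH_nerve (rbNrv \<R>) \<and> (\<forall>N. ribbon_nerve \<R> N \<longrightarrow> EH_nerve (subcollections N))"
proof (intro conjI allI impI)
  have R: "finite \<R>" "\<R> \<noteq> {}"
    using assms finite_rbx finite_subset by (auto simp: ribbon_complex_def)
  then show "EH_nerve (rbNrv \<R>)"
    unfolding EH_nerve_def using rbNrv_eq_Nrv by blast
  fix N assume "ribbon_nerve \<R> N"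
  then have N: "N \<noteq> {}" "N \<subseteq> \<R>" "\<Inter>N \<noteq> {}"
    unfolding ribbon_nerve_def by blast+
  have "finite N" "subcollections N = Nrv N"
    by (rule finite_subset[OF N(2) R(1)], rule subcollections_eq_Nrv[OF N(3)])
  \<comment> \<open>Here \<open>N\<close> itself serves as the finite collection \<open>F\<close>,
    as \<R> did above.\<close>
  then show "EH_nerve (subcollections N)"
    unfolding EH_nerve_def using N(1) by blast
qed

end
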